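(* Let $N\ge3$, $\kappa>0$, $\theta\in\mathbb R$, and assume $\alpha=\beta\in(0,1)$. Then the unique stationary measure $\mu_\alpha^N$ of the boundary-driven facilitated exclusion process with generator $\mathcal L_N$ on $\Omega_N$ is the restriction to $\Lambda_N$ of the grand-canonical measure $\pi_{\bar\rho(\alpha)}$, i.e. $$\forall\sigma\in\Omega_N,\qquad \mu_\alpha^N(\sigma)=\pi_{\bar\rho(\alpha)}\big(\eta_{|\Lambda_N}=\sigma\big).$$
   Context: $\Lambda_N=\{1,\dots,N-1\}$, $\Omega_N=\{0,1\}^{\Lambda_N}$. For $\eta\in\Omega_N$ use the convention $\eta_0:=\alpha$, $\eta_N:=\beta$. Let $\eta^{x,y}$ be the configuration obtained by exchanging the values at $x$ and $y$, and $\eta^x$ the one obtained by replacing $\eta_x$ by $1-\eta_x$. For $f:\Omega_N\to\mathbb R$, $$\mathcal L_0f(\eta)=\sum_{x=1}^{N-2}c_{x,x+1}(\eta)[f(\eta^{x,x+1})-f(\eta)],\quad c_{x,x+1}(\eta)=\eta_{x-1}\eta_x(1-\eta_{x+1})+(1-\eta_x)\eta_{x+1}\eta_{x+2},$$ $$\mathcal L_\ell f(\eta)=b_\ell(\eta)[f(\eta^1)-f(\eta)],\qquad b_\ell(\eta)=\alpha(1-\eta_1)+(1-\alpha)\eta_1\eta_2,$$ $$\mathcal L_rf(\eta)=b_r(\eta)[f(\eta^{N-1})-f(\eta)],\qquad b_r(\eta)=\beta(1-\eta_{N-1})+(1-\beta)\eta_{N-1}\eta_{N-2},$$ and $\mathcal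 L_N=\mathcal L_0+\kappa N^{-\theta}(\mathcal L_\ell+\mathcal L_r)$. $\mathfrak a(\rho)=\frac{2\rho-1}{\rho}$ for $\rho\in[\frac12,1]$, with inverse $\bar\rho(a)=\frac1{2-a}$, $a\in[0,1]$. For $\rho\in(\frac12,1]$, the grand-canonical measure $\pi_\rho$ is the translation invariant probability measure on $\{0,1\}^{\mathbb Z}$ which is the law of the stationary two-sided Markov chain $(\eta_x)_{x\in\mathbb Z}$ with $\pi_\rho(\eta_x=1)=\rho$, $\pi_\rho(\eta_{x+1}=1\mid\eta_x=1)=\mathfrak a(\rho)$ and $\pi_\rho(\eta_{x+1}=1\mid\eta_x=0)=1$. Equivalently (for $\rho<1$), for $\sigma\in\{0,1\}^{\{1,\dots,\ell\}}$ with $p=\sum_x\sigma_x$, $$\pi_\rho(\eta_{|\{1,\dots,\ell\}}=\sigma)=(1-\rho)(1-\mathfrak a(\rho))^{\ell-1-p}\mathfrak a(\rho)^{2p-\ell+1-\sigma_1-\sigma_\ell}$$ if $\sigma_x+\sigma_{x+1}\ge1$ for all $1\le x\le\ell-1$, and $0$ otherwise. *)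

theory Defs
  imports "HOL-Probability.Probability"
begin

section \<open>Configurations\<close>

text \<open>Sites are integers, so that the finite box and the two-sided infinite lattice share one index
  type. A configuration on the box is an extensional function with values in \<open>{0,1}\<close>.\<close>

definition sites :: "nat \<Rightarrow> int set" where
  "sites N = {1..int N - 1}"

definition configs :: "nat \<Rightarrow> (int \<Rightarrow> nat) set" where
  "configs N = (\<Pi>\<^sub>E x\<in>sites N. {0, 1})"

text \<open>Occupation variables with the reservoir convention: \<open>\<alpha>\<close> at site \<open>0\<close>, \<open>\<beta>\<close> at site \<open>N\<close>.\<close>

definition occ :: "nat \<Rightarrow> real \<Rightarrow> real \<Rightarrow> (int \<Rightarrow> nat) \<Rightarrow> int \<Rightarrow> real" where
  "occ N \<alpha> \<beta> \<eta> x = (if x = 0 then \<alpha> else if x = int N then \<beta> else real (\<eta> x))"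

definition exchange :: "(int \<Rightarrow> nat) \<Rightarrow> int \<Rightarrow> int \<Rightarrow> (int \<Rightarrow> nat)" where
  "exchange \<eta> x y = \<eta>(x := \<eta> y, y := \<eta> x)"

definition flip :: "(int \<Rightarrow> nat) \<Rightarrow> int \<Rightarrow> (int \<Rightarrow> nat)" where
  "flip \<eta> x = \<eta>(x := 1 - \<eta> x)"

section \<open>The boundary-driven facilitated exclusion process\<close>

definition bulk_rate :: "nat \<Rightarrow> real \<Rightarrow> real \<Rightarrow> int \<Rightarrow> (int \<Rightarrow> nat) \<Rightarrow> real" where
  "bulk_rate N \<alpha> \<beta> x \<eta> = (let e = occ N \<alpha> \<beta> \<eta> in
     e (x - 1) * e x * (1 - e (x + 1)) + (1 - e x) * e (x + 1) * e (x + 2))"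

definition left_rate :: "real \<Rightarrow> (int \<Rightarrow> nat) \<Rightarrow> real" where
  "left_rate \<alpha> \<eta> = \<alpha> * (1 - real (\<eta> 1)) + (1 - \<alpha>) * real (\<eta> 1) * real (\<eta> 2)"

definition right_rate :: "nat \<Rightarrow> real \<Rightarrow> (int \<Rightarrow> nat) \<Rightarrow> real" where
  "right_rate N \<beta> \<eta> = \<beta> * (1 - real (\<eta> (int N - 1)))
     + (1 - \<beta>) * real (\<eta> (int N - 1)) * real (\<eta> (int N - 2))"

type_synonym observable = "(int \<Rightarrow> nat) \<Rightarrow> real"

definition gen_bulk :: "nat \<Rightarrow> real \<Rightarrow> real \<Rightarrow> observable \<Rightarrow> observable" where
  "gen_bulk N \<alpha> \<beta> f \<eta> =
     (\<Sum>x\<in>{1..int N - 2}. bulk_rate N \<alpha> \<beta> x \<eta> * (f (exchange \<eta> x (x + 1)) - f \<eta>))"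

definition gen_left :: "real \<Rightarrow> observable \<Rightarrow> observable" where
  "gen_left \<alpha> f \<eta> = left_rate \<alpha> \<eta> * (f (flip \<eta> 1) - f \<eta>)"

definition gen_right :: "nat \<Rightarrow> real \<Rightarrow> observable \<Rightarrow> observable" where
  "gen_right N \<beta> f \<eta> = right_rate N \<beta> \<eta> * (f (flip \<eta> (int N - 1)) - f \<eta>)"

definition gen :: "nat \<Rightarrow> real \<Rightarrow> real \<Rightarrow> real \<Rightarrow> real \<Rightarrow> observable \<Rightarrow> observable" where
  "gen N \<kappa> \<theta> \<alpha> \<beta> f \<eta> =
     gen_bulk N \<alpha> \<beta> f \<eta> + \<kappa> * real N powr (- \<theta>) * (gen_left \<alpha> f \<eta> + gen_right N \<beta> f \<eta>)"

text \<open>The Markov semigroup \<open>exp (t L)\<close>. The series converges at every \<open>\<eta> \<in> configs N\<close>, since the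
  generator acts as a matrix on functions on the finite set \<open>configs N\<close>.\<close>

definition semigroup_FEP ::
  "nat \<Rightarrow> real \<Rightarrow> real \<Rightarrow> real \<Rightarrow> real \<Rightarrow> real \<Rightarrow> observable \<Rightarrow> observable" where
  "semigroup_FEP N \<kappa> \<theta> \<alpha> \<beta> t f \<eta> = (\<Sum>n. t ^ n / fact n * ((gen N \<kappa> \<theta> \<alpha> \<beta> ^^ n) f) \<eta>)"

definition stationary_FEP ::
  "nat \<Rightarrow> real \<Rightarrow> real \<Rightarrow> real \<Rightarrow> real \<Rightarrow> (int \<Rightarrow> nat) pmf \<Rightarrow> bool" where
  "stationary_FEP N \<kappa> \<theta> \<alpha> \<beta> \<mu> \<longleftrightarrow> set_pmf \<mu> \<subseteq> configs N \<and>
     (\<forall>t\<ge>0. \<forall>f. measure_pmf.expectation \<mu> (semigroup_FEP N \<kappa> \<theta> \<alpha> \<beta> t f)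
                = measure_pmf.expectation \<mu> f)"

section \<open>Grand-canonical measures\<close>

definition active_density :: "real \<Rightarrow> real" where
  "active_density \<rho> = (2 * \<rho> - 1) / \<rho>"

definition rho_bar :: "real \<Rightarrow> real" where
  "rho_bar a = 1 / (2 - a)"

definition lattice_space :: "(int \<Rightarrow> nat) measure" where
  "lattice_space = (\<Pi>\<^sub>M x\<in>(UNIV :: int set). count_space {0, 1})"

definition gc_transition :: "real \<Rightarrow> nat \<Rightarrow> nat \<Rightarrow> real" where
  "gc_transition \<rho> i j =
     (if i = 1 then (if j = 1 then active_density \<rho> else 1 - active_density \<rho>)
      else (if j = 1 then 1 else 0))"

text \<open>The last clause is the Markov property with transition matrix \<open>gc_transition \<rho>\<close>, multiplied
  out so that conditioning on null events is harmless (the value \<open>0\<close> is null when \<open>\<rho> = 1\<close>).\<close>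

definition is_grand_canonical :: "real \<Rightarrow> (int \<Rightarrow> nat) measure \<Rightarrow> bool" where
  "is_grand_canonical \<rho> M \<longleftrightarrow>
     prob_space M \<and> sets M = sets lattice_space \<and>
     distr M M (\<lambda>\<eta> x. \<eta> (x + 1)) = M \<and>
     (\<forall>x. measure M {\<eta> \<in> space M. \<eta> x = 1} = \<rho>) \<and>
     (\<forall>x y. x \<le> y \<longrightarrow> (\<forall>\<sigma> \<in> UNIV \<rightarrow> {0, 1}.
        measure M {\<eta> \<in> space M. \<forall>z\<in>{x..y + 1}. \<eta> z = \<sigma> z}
          = measure M {\<eta> \<in> space M. \<forall>z\<in>{x..y}. \<eta> z = \<sigma> z}
            * gc_transition \<rho> (\<sigma> y) (\<sigma> (y + 1))))"

text \<open>Meaningful for \<open>1/2 < \<rho>\<close> and \<open>\<rho> \<le> 1\<close>, where the measure exists and is unique.\<close>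

definition grand_canonical :: "real \<Rightarrow> (int \<Rightarrow> nat) measure" where
  "grand_canonical \<rho> = (THE M. is_grand_canonical \<rho> M)"

end

theory Submission
  imports Defs "HOL-Complex_Analysis.Cauchy_Integral_Formula"
begin

text \<open>For equal reservoir densities the restricted grand-canonical measure is not only stationary but
  reversible, move by move. Its weight is the one-site marginal at site \<open>1\<close> times a product of
  transition probabilities over the bonds, and no configuration that it charges has two adjacent
  holes. In the bulk, an allowed exchange is \<open>1101 \<leftrightarrow> 1011\<close>, at rate \<open>1\<close> both ways, and both sides carry
  the same transition probabilities. Next to a reservoir, the missing neighbour is replaced by the
  constant \<open>\<alpha>\<close> in the rate, and the bond to that neighbour drops out of the weight: the two
  changes compensate each other exactly when \<open>\<alpha>\<close> is the probability of a transition from \<open>1\<close> to \<open>1\<close>,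
  that is for the density \<open>rho_bar \<alpha>\<close>. The reservoir flips are balanced because the two-state chain is
  reversible. This is \<open>weight_detailed_balance\<close>.

  Uniqueness cannot come from irreducibility, because configurations with adjacent holes are
  transient. But any configuration can be filled up: the leftmost hole has only particles (or the
  reservoir) to its left, so it can travel to site \<open>1\<close> and be filled there. Hence every nonempty closed
  set contains the full configuration (\<open>full_in_closed_set\<close>). If two stationary laws differed, the
  sets where their difference is positive and where it is negative would both be nonempty, closed
  and disjoint (\<open>positive_part_closed\<close>, \<open>stationary_unique\<close>).

  The grand-canonical measure is given by a definite description, so its existence and uniqueness
  belong to the proof. Uniqueness holds because the Markov property and the density fix all cylinder
  probabilities. For existence, the two-sided chain is written as a function of independent coin
  tosses \<open>\<xi>\<close>: site \<open>x\<close> is to be empty iff \<open>\<xi> x\<close> holds and site \<open>x - 1\<close> is occupied. A false toss forces a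
  particle and makes the past irrelevant, so \<open>x\<close> is empty iff the run of true tosses that ends at \<open>x\<close>
  has odd length. Stationarity and the Markov property are then inherited from the tosses.\<close>

section \<open>Stationary laws of finite jump processes\<close>

text \<open>A continuous-time chain on a finite set in which move \<open>j\<close> takes place at rate \<open>rate j \<eta>\<close>. Moves are
  kept apart, instead of being summed into a matrix of rates, because detailed balance will hold for
  each of them separately.\<close>

locale jump_process =
  fixes S :: "'a set" and J :: "'j set" and rate :: "'j \<Rightarrow> 'a \<Rightarrow> real" and move :: "'j \<Rightarrow> 'a \<Rightarrow> 'a"
  assumes finite_states: "finite S" and finite_moves: "finite J"
    and move_closed: "\<And>j \<eta>. j \<in> J \<Longrightarrow> \<eta> \<in> S \<Longrightarrow> move j \<eta> \<in> S"
    and rate_nonneg: "\<And>j \<eta>. j \<in> J \<Longrightarrow> \<eta> \<in> S \<Longrightarrow> 0 \<le> rate j \<eta>"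
begin

definition generator :: "('a \<Rightarrow> real) \<Rightarrow> 'a \<Rightarrow> real" where
  "generator f \<eta> = (\<Sum>j\<in>J. rate j \<eta> * (f (move j \<eta>) - f \<eta>))"

definition markov_semigroup :: "real \<Rightarrow> ('a \<Rightarrow> real) \<Rightarrow> 'a \<Rightarrow> real" where
  "markov_semigroup t f \<eta> = (\<Sum>n. t ^ n / fact n * (generator ^^ n) f \<eta>)"

definition closed_set :: "'a set \<Rightarrow> bool" where
  "closed_set A \<longleftrightarrow> (\<forall>\<eta>\<in>A. \<forall>j\<in>J. 0 < rate j \<eta> \<longrightarrow> move j \<eta> \<in> A)"

lemma expectation_eq_sum:
  assumes "set_pmf \<mu> \<subseteq> S"
  shows "measure_pmf.expectation \<mu> f = (\<Sum>\<eta>\<in>S. pmf \<mu> \<eta> * f \<eta>)"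
  using integral_measure_pmf[OF finite_states, of \<mu> f] assms by auto

lemma generator_pow_bound:
  obtains C K where "\<And>n \<eta>. \<eta> \<in> S \<Longrightarrow> \<bar>(generator ^^ n) f \<eta>\<bar> \<le> C ^ n * K"
proof -
  define R where "R = (\<Sum>\<eta>\<in>S. \<Sum>j\<in>J. rate j \<eta>)"
  define K where "K = (\<Sum>\<eta>\<in>S. \<bar>f \<eta>\<bar>)"
  have R: "(\<Sum>j\<in>J. rate j \<eta>) \<le> R" if "\<eta> \<in> S" for \<eta>
    unfolding R_def using that rate_nonneg
    by (intro member_le_sum[of \<eta> S "\<lambda>\<eta>. \<Sum>j\<in>J. rate j \<eta>"] finite_states sum_nonneg) auto
  have "\<bar>(generator ^^ n) f \<eta>\<bar> \<le> (2 * R) ^ n * K" if "\<eta> \<in> S" for n \<eta>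
    using that
  proof (induction n arbitrary: \<eta>)
    case 0
    then show ?case
      unfolding K_def using member_le_sum[of \<eta> S "\<lambda>\<eta>. \<bar>f \<eta>\<bar>"] finite_states by simp
  next
    case (Suc n)
    let ?g = "(generator ^^ n) f" and ?B = "(2 * R) ^ n * K"
    have B: "0 \<le> ?B"
      using Suc.IH[OF Suc.prems] by linarith
    have "\<bar>generator ?g \<eta>\<bar> \<le> (\<Sum>j\<in>J. \<bar>rate j \<eta> * (?g (move j \<eta>) - ?g \<eta>)\<bar>)"
      unfolding generator_def by (rule sum_abs)
    also have "\<dots> \<le> (\<Sum>j\<in>J. rate j \<eta> * (2 * ?B))"
    proof (rule sum_mono)
      fix j assume j: "j \<in> J"
      have "\<bar>?g (move j \<eta>) - ?g \<eta>\<bar> \<le> 2 * ?B"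
        using Suc.IH[OF Suc.prems] Suc.IH[OF move_closed[OF j Suc.prems]] by linarith
      then show "\<bar>rate j \<eta> * (?g (move j \<eta>) - ?g \<eta>)\<bar> \<le> rate j \<eta> * (2 * ?B)"
        using rate_nonneg[OF j Suc.prems] by (simp add: abs_mult mult_left_mono)
    qed
    also have "\<dots> = (\<Sum>j\<in>J. rate j \<eta>) * (2 * ?B)"
      by (simp add: sum_distrib_right)
    also have "\<dots> \<le> R * (2 * ?B)"
      using R[OF Suc.prems] B by (intro mult_right_mono) auto
    finally show ?case by (simp add: mult_ac)
  qed
  then show ?thesis using that by blast
qed

text \<open>Averaging the exponential series of the semigroup is a finite sum over states, so it commutes with
  the series: the average at time \<open>t\<close> is a power series in \<open>t\<close> that converges everywhere.\<close>

lemma semigroup_expectation_sums: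
  assumes "set_pmf \<mu> \<subseteq> S"
  shows "(\<lambda>n. measure_pmf.expectation \<mu> ((generator ^^ n) f) / fact n * t ^ n)
           sums measure_pmf.expectation \<mu> (markov_semigroup t f)"
proof -
  obtain C K where bound: "\<And>n \<eta>. \<eta> \<in> S \<Longrightarrow> \<bar>(generator ^^ n) f \<eta>\<bar> \<le> C ^ n * K"
    using generator_pow_bound by blast
  have sums: "(\<lambda>n. t ^ n / fact n * (generator ^^ n) f \<eta>) sums markov_semigroup t f \<eta>" if "\<eta> \<in> S" for \<eta>
    unfolding markov_semigroup_def
  proof (rule summable_sums, rule summable_comparison_test')
    show "summable (\<lambda>n. inverse (fact n) * (\<bar>t\<bar> * C) ^ n * K)"
      by (intro summable_mult2 summable_exp)
    fix n :: nat
    have "norm (t ^ n / fact n * (generator ^^ n) f \<eta>) = \<bar>t\<bar> ^ n / fact n * \<bar>(generator ^^ n) f \<eta>\<bar>"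
      by (simp add: abs_mult power_abs)
    also have "\<dots> \<le> \<bar>t\<bar> ^ n / fact n * (C ^ n * K)"
      using bound[OF that] by (intro mult_left_mono) auto
    finally show "norm (t ^ n / fact n * (generator ^^ n) f \<eta>) \<le> inverse (fact n) * (\<bar>t\<bar> * C) ^ n * K"
      by (simp add: power_mult_distrib field_simps)
  qed
  have "(\<lambda>n. \<Sum>\<eta>\<in>S. pmf \<mu> \<eta> * (t ^ n / fact n * (generator ^^ n) f \<eta>))
          sums (\<Sum>\<eta>\<in>S. pmf \<mu> \<eta> * markov_semigroup t f \<eta>)"
    by (intro sums_sum sums_mult sums)
  moreover have "(\<Sum>\<eta>\<in>S. pmf \<mu> \<eta> * (t ^ n / fact n * (generator ^^ n) f \<eta>))
      = measure_pmf.expectation \<mu> ((generator ^^ n) f) / fact n * t ^ n" for n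
    unfolding expectation_eq_sum[OF assms] sum_divide_distrib sum_distrib_right
    by (rule sum.cong) auto
  ultimately show ?thesis
    by (simp add: expectation_eq_sum[OF assms])
qed

text \<open>The average of the semigroup is a power series in \<open>t\<close> whose linear coefficient is the average of the
  generator. If it is constant for \<open>t \<ge> 0\<close>, then \<open>0\<close> is a zero of the series without its constant term
  that is not isolated, so that all its coefficients vanish; conversely, an average of the generator
  that vanishes for all observables kills all higher coefficients, as these are averages of the
  generator too.\<close>

lemma stationary_iff_generator:
  assumes "set_pmf \<mu> \<subseteq> S"
  shows "(\<forall>t\<ge>0. \<forall>f. measure_pmf.expectation \<mu> (markov_semigroup t f) = measure_pmf.expectation \<mu> f)
     \<longleftrightarrow> (\<forall>f. measure_pmf.expectation \<mu> (generator f) = 0)"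
proof (intro iffI allI impI)
  fix f
  assume st: "\<forall>t\<ge>0. \<forall>f. measure_pmf.expectation \<mu> (markov_semigroup t f) = measure_pmf.expectation \<mu> f"
  \<comment> \<open>The constant term is removed, so that \<open>?F\<close> vanishes on the whole half-line \<open>t \<ge> 0\<close>.\<close>
  let ?c = "\<lambda>n. if n = 0 then 0 else measure_pmf.expectation \<mu> ((generator ^^ n) f) / fact n"
  let ?F = "\<lambda>t. measure_pmf.expectation \<mu> (markov_semigroup t f) - measure_pmf.expectation \<mu> f"
  have series: "(\<lambda>n. ?c n * (t - 0) ^ n) sums ?F t" for t
  proof -
    have "(\<lambda>n. measure_pmf.expectation \<mu> ((generator ^^ n) f) / fact n * t ^ n
             - (if n = 0 then measure_pmf.expectation \<mu> f else 0)) sums ?F t"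
      by (intro sums_diff semigroup_expectation_sums[OF assms] sums_single[of 0 "\<lambda>_. measure_pmf.expectation \<mu> f"])
    moreover have "(\<lambda>n. measure_pmf.expectation \<mu> ((generator ^^ n) f) / fact n * t ^ n
             - (if n = 0 then measure_pmf.expectation \<mu> f else 0)) = (\<lambda>n. ?c n * (t - 0) ^ n)"
      by auto
    ultimately show ?thesis by simp
  qed
  show "measure_pmf.expectation \<mu> (generator f) = 0"
  proof (rule ccontr)
    assume "measure_pmf.expectation \<mu> (generator f) \<noteq> 0"
    then obtain s where "0 < s" "\<And>t. t \<in> cball 0 s - {0} \<Longrightarrow> ?F t \<noteq> 0"
      using powser_0_nonzero[of 1 0 ?c ?F 1] series st by auto
    from this(2)[of s] \<open>0 < s\<close> st show False by auto
  qed
next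
  fix f t
  assume inv: "\<forall>f. measure_pmf.expectation \<mu> (generator f) = 0"
  have "measure_pmf.expectation \<mu> ((generator ^^ n) f) = (if n = 0 then measure_pmf.expectation \<mu> f else 0)" for n
    using inv by (cases n) auto
  then have "(\<lambda>n. measure_pmf.expectation \<mu> ((generator ^^ n) f) / fact n * t ^ n)
      = (\<lambda>n. if n = 0 then measure_pmf.expectation \<mu> f else 0)"
    by auto
  with semigroup_expectation_sums[OF assms, of f t] sums_single[of 0 "\<lambda>_. measure_pmf.expectation \<mu> f"]
  show "measure_pmf.expectation \<mu> (markov_semigroup t f) = measure_pmf.expectation \<mu> f"
    using sums_unique2 by metis
qed

text \<open>Test the stationarity of \<open>d\<close> against the indicator of \<open>A = {d > 0}\<close>. A jump out of \<open>A\<close> contributes with a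
  negative sign and weight \<open>d > 0\<close>, a jump into \<open>A\<close> with a positive sign and weight \<open>d \<le> 0\<close>: all terms of
  a vanishing sum have the same sign, so there is no jump out of \<open>A\<close>.\<close>

lemma positive_part_closed:
  fixes d :: "'a \<Rightarrow> real"
  assumes inv: "\<And>f. (\<Sum>\<eta>\<in>S. d \<eta> * generator f \<eta>) = 0"
  shows "closed_set {\<eta> \<in> S. 0 < d \<eta>}"
proof -
  define A where "A = {\<eta> \<in> S. 0 < d \<eta>}"
  let ?f = "\<lambda>\<eta>. of_bool (\<eta> \<in> A) :: real"
  let ?g = "\<lambda>\<eta> j. d \<eta> * (rate j \<eta> * (?f (move j \<eta>) - ?f \<eta>))"
  have le: "?g \<eta> j \<le> 0" if "\<eta> \<in> S" "j \<in> J" for \<eta> j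
    using rate_nonneg[OF that(2,1)] that
    by (cases "\<eta> \<in> A"; cases "move j \<eta> \<in> A") (auto simp: A_def mult_nonpos_nonneg)
  have "(\<Sum>\<eta>\<in>S. \<Sum>j\<in>J. - ?g \<eta> j) = 0"
    using inv[of ?f] by (simp add: generator_def sum_negf sum_distrib_left)
  then have zero: "?g \<eta> j = 0" if "\<eta> \<in> S" "j \<in> J" for \<eta> j
    using that le finite_states finite_moves
    by (smt (verit) sum_nonneg_eq_0_iff sum_nonneg)
  have "move j \<eta> \<in> A" if "\<eta> \<in> A" "j \<in> J" "0 < rate j \<eta>" for \<eta> j
    using zero[of \<eta> j] that by (auto simp: A_def)
  then show ?thesis
    unfolding closed_set_def A_def[symmetric] by blast
qed

text \<open>Two different probability laws have a difference that takes both signs. Both sign sets are closed,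
  so both would contain the state \<open>e\<close> that all closed sets share.\<close>

lemma stationary_unique:
  assumes reach: "\<And>A. A \<subseteq> S \<Longrightarrow> A \<noteq> {} \<Longrightarrow> closed_set A \<Longrightarrow> e \<in> A"
    and \<mu>: "set_pmf \<mu> \<subseteq> S" "\<And>f. measure_pmf.expectation \<mu> (generator f) = 0"
    and \<nu>: "set_pmf \<nu> \<subseteq> S" "\<And>f. measure_pmf.expectation \<nu> (generator f) = 0"
  shows "\<mu> = \<nu>"
proof -
  define d where "d = (\<lambda>\<eta>. pmf \<mu> \<eta> - pmf \<nu> \<eta>)"
  have inv: "(\<Sum>\<eta>\<in>S. d \<eta> * generator f \<eta>) = 0" for f
    using \<mu>(2)[of f] \<nu>(2)[of f] 
    by (simp add: d_def expectation_eq_sum[OF \<mu>(1)] expectation_eq_sum[OF \<nu>(1)] left_diff_distrib sum_subtractf)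
  then have inv': "(\<Sum>\<eta>\<in>S. - d \<eta> * generator f \<eta>) = 0" for f
    by (simp add: sum_negf)
  have total: "(\<Sum>\<eta>\<in>S. d \<eta>) = 0"
    using sum_pmf_eq_1[OF finite_states \<mu>(1)] sum_pmf_eq_1[OF finite_states \<nu>(1)]
    by (simp add: d_def sum_subtractf)
  have "{\<eta> \<in> S. 0 < d \<eta>} = {} \<or> {\<eta> \<in> S. 0 < - d \<eta>} = {}"
    using reach[OF _ _ positive_part_closed[OF inv]] reach[OF _ _ positive_part_closed[OF inv']] by force
  then have "(\<forall>\<eta>\<in>S. 0 \<le> - d \<eta>) \<or> (\<forall>\<eta>\<in>S. 0 \<le> d \<eta>)"
    by force
  then have "\<forall>\<eta>\<in>S. d \<eta> = 0"
  proof
    assume "\<forall>\<eta>\<in>S. 0 \<le> d \<eta>"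
    then show ?thesis
      using total sum_nonneg_eq_0_iff[OF finite_states, of d] by simp
  next
    assume "\<forall>\<eta>\<in>S. 0 \<le> - d \<eta>"
    then show ?thesis
      using total sum_nonneg_eq_0_iff[OF finite_states, of "\<lambda>\<eta>. - d \<eta>"] by (simp add: sum_negf)
  qed
  then have "pmf \<mu> \<eta> = pmf \<nu> \<eta>" for \<eta>
  proof (cases "\<eta> \<in> S")
    case False
    then have "\<eta> \<notin> set_pmf \<mu>" "\<eta> \<notin> set_pmf \<nu>"
      using \<mu>(1) \<nu>(1) by auto
    then show ?thesis
      by (simp add: set_pmf_iff)
  qed (simp add: d_def)
  then show ?thesis
    by (rule pmf_eqI)
qed

text \<open>Detailed balance of an involutive move makes its share of the generator average to \<open>0\<close>: the
  substitution \<open>\<eta> \<mapsto> move j \<eta>\<close> exchanges the gain term with the loss term.\<close>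

lemma reversible_invariant:
  fixes w :: "'a \<Rightarrow> real"
  assumes involutive: "\<And>j \<eta>. j \<in> J \<Longrightarrow> \<eta> \<in> S \<Longrightarrow> move j (move j \<eta>) = \<eta>"
    and balance: "\<And>j \<eta>. j \<in> J \<Longrightarrow> \<eta> \<in> S \<Longrightarrow> w \<eta> * rate j \<eta> = w (move j \<eta>) * rate j (move j \<eta>)"
  shows "(\<Sum>\<eta>\<in>S. w \<eta> * generator f \<eta>) = 0"
proof -
  have "(\<Sum>\<eta>\<in>S. w \<eta> * rate j \<eta> * f (move j \<eta>)) = (\<Sum>\<eta>\<in>S. w \<eta> * rate j \<eta> * f \<eta>)" if "j \<in> J" for j
    by (rule sum.reindex_bij_witness[of _ "move j" "move j"])
      (simp_all add: involutive[OF that] move_closed[OF that] balance[OF that, symmetric])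
  then have "(\<Sum>j\<in>J. \<Sum>\<eta>\<in>S. w \<eta> * (rate j \<eta> * (f (move j \<eta>) - f \<eta>))) = 0"
    by (intro sum.neutral) (simp add: right_diff_distrib sum_subtractf mult.assoc)
  then show ?thesis
    unfolding generator_def sum_distrib_left by (subst sum.swap)
qed

end

section \<open>The facilitated exclusion process as a jump process\<close>

text \<open>The moves are indexed by \<open>{0..N - 1}\<close>, one for each bond of the box extended by its two
  reservoirs: the flips at the ends have the indices \<open>0\<close> and \<open>N - 1\<close>, the exchange of \<open>x\<close> and \<open>x + 1\<close> has the index \<open>x\<close>.\<close>

definition fep_rate :: "nat \<Rightarrow> real \<Rightarrow> real \<Rightarrow> real \<Rightarrow> real \<Rightarrow> int \<Rightarrow> (int \<Rightarrow> nat) \<Rightarrow> real" where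
  "fep_rate N \<kappa> \<theta> \<alpha> \<beta> x \<eta> =
     (if x = 0 then \<kappa> * real N powr (- \<theta>) * left_rate \<alpha> \<eta>
      else if x = int N - 1 then \<kappa> * real N powr (- \<theta>) * right_rate N \<beta> \<eta>
      else bulk_rate N \<alpha> \<beta> x \<eta>)"

definition fep_move :: "nat \<Rightarrow> int \<Rightarrow> (int \<Rightarrow> nat) \<Rightarrow> (int \<Rightarrow> nat)" where
  "fep_move N x \<eta> =
     (if x = 0 then flip \<eta> 1 else if x = int N - 1 then flip \<eta> (int N - 1) else exchange \<eta> x (x + 1))"

lemma configs_values: "\<eta> \<in> configs N \<Longrightarrow> x \<in> sites N \<Longrightarrow> \<eta> x = 0 \<or> \<eta> x = 1"
  by (auto simp: configs_def PiE_iff)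

lemma finite_configs: "finite (configs N)"
  unfolding configs_def sites_def by (intro finite_PiE) auto

lemma fep_move_closed:
  assumes "N \<ge> 3" "x \<in> {0..int N - 1}" "\<eta> \<in> configs N"
  shows "fep_move N x \<eta> \<in> configs N"
  using assms by (auto simp: fep_move_def flip_def exchange_def configs_def sites_def PiE_iff extensional_def)

lemma fep_move_involutive:
  assumes "N \<ge> 3" "x \<in> {0..int N - 1}" "\<eta> \<in> configs N"
  shows "fep_move N x (fep_move N x \<eta>) = \<eta>"
proof -
  have "flip (flip \<eta> y) y = \<eta>" if "y \<in> sites N" for y
    using configs_values[OF assms(3) that] by (auto simp: flip_def)
  moreover have "exchange (exchange \<eta> x (x + 1)) x (x + 1) = \<eta>"
    by (auto simp: exchange_def)
  ultimately show ?thesis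
    using assms(1) by (auto simp: fep_move_def sites_def)
qed

lemma occ_in_unit_interval:
  assumes "\<alpha> \<in> {0..1}" "\<beta> \<in> {0..1}" "\<eta> \<in> configs N" "x \<in> {0..int N}"
  shows "occ N \<alpha> \<beta> \<eta> x \<in> {0..1}"
  using assms configs_values[OF assms(3), of x] by (auto simp: occ_def sites_def)

lemma fep_rate_nonneg:
  assumes "N \<ge> 3" "\<kappa> \<ge> 0" "\<alpha> \<in> {0..1}" "\<beta> \<in> {0..1}" "x \<in> {0..int N - 1}" "\<eta> \<in> configs N"
  shows "0 \<le> fep_rate N \<kappa> \<theta> \<alpha> \<beta> x \<eta>"
proof -
  have "0 \<le> left_rate \<alpha> \<eta>" "0 \<le> right_rate N \<beta> \<eta>"
    using assms configs_values[OF assms(6), of 1] configs_values[OF assms(6), of "int N - 1"]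
    by (auto simp: left_rate_def right_rate_def sites_def)
  moreover have "0 \<le> bulk_rate N \<alpha> \<beta> x \<eta>" if "x \<noteq> 0" "x \<noteq> int N - 1"
  proof -
    have "occ N \<alpha> \<beta> \<eta> y \<in> {0..1}" if "y \<in> {x - 1..x + 2}" for y
      using that assms \<open>x \<noteq> 0\<close> \<open>x \<noteq> int N - 1\<close> by (intro occ_in_unit_interval) auto
    then show ?thesis
      unfolding bulk_rate_def Let_def by (intro add_nonneg_nonneg mult_nonneg_nonneg) auto
  qed
  ultimately show ?thesis
    using assms(2) by (simp add: fep_rate_def)
qed

lemma fep_jump_process:
  assumes "N \<ge> 3" "\<kappa> \<ge> 0" "\<alpha> \<in> {0..1}" "\<beta> \<in> {0..1}"
  shows "jump_process (configs N) {0..int N - 1} (fep_rate N \<kappa> \<theta> \<alpha> \<beta>) (fep_move N)"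
  using assms by unfold_locales (auto intro: finite_configs fep_move_closed fep_rate_nonneg)

lemma gen_eq_generator:
  assumes "N \<ge> 3" "\<kappa> \<ge> 0" "\<alpha> \<in> {0..1}" "\<beta> \<in> {0..1}"
  shows "gen N \<kappa> \<theta> \<alpha> \<beta> = jump_process.generator {0..int N - 1} (fep_rate N \<kappa> \<theta> \<alpha> \<beta>) (fep_move N)"
proof (intro ext)
  fix f \<eta>
  let ?g = "\<lambda>x. fep_rate N \<kappa> \<theta> \<alpha> \<beta> x \<eta> * (f (fep_move N x \<eta>) - f \<eta>)"
  have "{0..int N - 1} = insert 0 (insert (int N - 1) {1..int N - 2})"
    using assms(1) by auto
  then have "sum ?g {0..int N - 1} = ?g 0 + (?g (int N - 1) + sum ?g {1..int N - 2})"
    using assms(1) by simp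
  also have "sum ?g {1..int N - 2} = gen_bulk N \<alpha> \<beta> f \<eta>"
    unfolding gen_bulk_def by (rule sum.cong) (auto simp: fep_rate_def fep_move_def)
  also have "?g 0 + (?g (int N - 1) + gen_bulk N \<alpha> \<beta> f \<eta>) = gen N \<kappa> \<theta> \<alpha> \<beta> f \<eta>"
    using assms(1)
    by (simp add: gen_def gen_left_def gen_right_def fep_rate_def fep_move_def algebra_simps)
  finally show "gen N \<kappa> \<theta> \<alpha> \<beta> f \<eta>
      = jump_process.generator {0..int N - 1} (fep_rate N \<kappa> \<theta> \<alpha> \<beta>) (fep_move N) f \<eta>"
    by (simp add: jump_process.generator_def[OF fep_jump_process[OF assms]])
qed

lemma stationary_FEP_iff:
  assumes "N \<ge> 3" "\<kappa> \<ge> 0" "\<alpha> \<in> {0..1}" "\<beta> \<in> {0..1}"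
  shows "stationary_FEP N \<kappa> \<theta> \<alpha> \<beta> \<mu> \<longleftrightarrow>
    set_pmf \<mu> \<subseteq> configs N \<and> (\<forall>f. measure_pmf.expectation \<mu> (gen N \<kappa> \<theta> \<alpha> \<beta> f) = 0)"
proof -
  interpret jump_process "configs N" "{0..int N - 1}" "fep_rate N \<kappa> \<theta> \<alpha> \<beta>" "fep_move N"
    using assms by (rule fep_jump_process)
  have "semigroup_FEP N \<kappa> \<theta> \<alpha> \<beta> = markov_semigroup"
    by (intro ext) (simp add: semigroup_FEP_def markov_semigroup_def gen_eq_generator[OF assms])
  then show ?thesis
    unfolding stationary_FEP_def gen_eq_generator[OF assms]
    using stationary_iff_generator by auto
qed

section \<open>Every configuration can be filled up\<close>

text \<open>The holes weighted by their distance to the left reservoir. Moving a hole one step to the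
  left decreases this number, and so does filling a hole at site \<open>1\<close>.\<close>

definition vacancy_potential :: "nat \<Rightarrow> (int \<Rightarrow> nat) \<Rightarrow> nat" where
  "vacancy_potential N \<eta> = (\<Sum>x\<in>sites N. (1 - \<eta> x) * nat x)"

text \<open>The move in question acts on the leftmost hole \<open>y\<close>. It is filled by the reservoir if \<open>y = 1\<close>;
  otherwise it is exchanged with the particle at \<open>y - 1\<close>, whose jump is allowed as it has a particle,
  or the left reservoir, behind it.\<close>

lemma vacancy_potential_decreases:
  assumes \<eta>: "\<eta> \<in> configs N" and N: "N \<ge> 3" and nonfull: "\<eta> \<noteq> (\<lambda>x\<in>sites N. 1)"
    and "\<kappa> > 0" "0 < \<alpha>"
  shows "\<exists>x\<in>{0..int N - 1}. 0 < fep_rate N \<kappa> \<theta> \<alpha> \<alpha> x \<eta> \<and>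
    vacancy_potential N (fep_move N x \<eta>) < vacancy_potential N \<eta>"
proof -
  have "\<exists>x\<in>sites N. \<eta> x = 0"
  proof (rule ccontr)
    assume "\<not> ?thesis"
    then have "\<eta> x = 1" if "x \<in> sites N" for x
      using configs_values[OF \<eta> that] that by auto
    moreover have "\<eta> x = undefined" if "x \<notin> sites N" for x
      using \<eta> that by (auto simp: configs_def PiE_iff extensional_def)
    ultimately have "\<eta> = (\<lambda>x\<in>sites N. 1)"
      by auto
    with nonfull show False ..
  qed
  then obtain k where k: "1 + int k \<in> sites N \<and> \<eta> (1 + int k) = 0"
    by (metis atLeastAtMost_iff sites_def zle_iff_zadd)
  \<comment> \<open>The leftmost hole is \<open>y = 1 + k0\<close>; it is found through the offset, as least elements exist on \<open>nat\<close>.\<close>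
  define k0 where "k0 = (LEAST k. 1 + int k \<in> sites N \<and> \<eta> (1 + int k) = 0)"
  define y where "y = 1 + int k0"
  have y: "y \<in> sites N" "\<eta> y = 0"
    using LeastI[of "\<lambda>k. 1 + int k \<in> sites N \<and> \<eta> (1 + int k) = 0", OF k]
    unfolding y_def k0_def by auto
  have left: "\<eta> z = 1" if "1 \<le> z" "z < y" for z
  proof -
    have "\<not> (1 + int (nat (z - 1)) \<in> sites N \<and> \<eta> (1 + int (nat (z - 1))) = 0)"
      using that unfolding y_def k0_def by (intro not_less_Least) linarith
    then show ?thesis
      using that y configs_values[OF \<eta>, of z] by (auto simp: sites_def)
  qed
  have fin: "finite (sites N)"
    by (simp add: sites_def)
  show ?thesis
  proof (cases "y = 1")
    case True
    have "vacancy_potential N (flip \<eta> 1) < vacancy_potential N \<eta>"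
      unfolding vacancy_potential_def
    proof (rule sum_strict_mono_ex1[OF fin])
      show "\<exists>x\<in>sites N. (1 - flip \<eta> 1 x) * nat x < (1 - \<eta> x) * nat x"
        using y True by (intro bexI[of _ 1]) (auto simp: flip_def)
    qed (use y True in \<open>auto simp: flip_def\<close>)
    moreover have "0 < left_rate \<alpha> \<eta>"
      using y True \<open>0 < \<alpha>\<close> by (simp add: left_rate_def)
    ultimately show ?thesis
      using N \<open>\<kappa> > 0\<close> by (intro bexI[of _ 0]) (auto simp: fep_rate_def fep_move_def)
  next
    case False
    let ?x = "y - 1" and ?\<eta>' = "exchange \<eta> (y - 1) y"
    have x: "1 \<le> ?x" "?x \<in> sites N" "?x \<le> int N - 2"
      using False y by (auto simp: sites_def)
    have split: "vacancy_potential N \<xi> = (1 - \<xi> ?x) * nat ?x + ((1 - \<xi> y) * nat y +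
        (\<Sum>z\<in>sites N - {?x} - {y}. (1 - \<xi> z) * nat z))" for \<xi>
      unfolding vacancy_potential_def
      using sum.remove[OF fin x(2), of "\<lambda>z. (1 - \<xi> z) * nat z"]
        sum.remove[of "sites N - {?x}" y "\<lambda>z. (1 - \<xi> z) * nat z"] fin y by simp
    have rest: "(\<Sum>z\<in>sites N - {?x} - {y}. (1 - ?\<eta>' z) * nat z) = (\<Sum>z\<in>sites N - {?x} - {y}. (1 - \<eta> z) * nat z)"
      by (rule sum.cong) (auto simp: exchange_def)
    have "\<eta> ?x = 1"
      using left x by simp
    then have "vacancy_potential N ?\<eta>' < vacancy_potential N \<eta>"
      unfolding split rest using y x by (simp add: exchange_def)
    moreover have "0 < bulk_rate N \<alpha> \<alpha> ?x \<eta>"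
    proof -
      have "0 < occ N \<alpha> \<alpha> \<eta> (?x - 1)"
        using left[of "?x - 1"] x \<open>0 < \<alpha>\<close> by (auto simp: occ_def)
      moreover have "occ N \<alpha> \<alpha> \<eta> ?x = 1" "occ N \<alpha> \<alpha> \<eta> (?x + 1) = 0"
        using \<open>\<eta> ?x = 1\<close> y x by (auto simp: occ_def sites_def)
      ultimately show ?thesis
        by (simp add: bulk_rate_def)
    qed
    ultimately show ?thesis
      using x by (intro bexI[of _ ?x]) (auto simp: fep_rate_def fep_move_def)
  qed
qed

text \<open>From a state with holes, some possible move decreases the potential and stays in the closed set; hence
  a state of least potential in the set has no holes.\<close>

lemma full_in_closed_set:
  assumes "N \<ge> 3" "\<kappa> > 0" "0 < \<alpha>" "\<alpha> < 1"
    and A: "A \<subseteq> configs N" "A \<noteq> {}"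
    and closed: "jump_process.closed_set {0..int N - 1} (fep_rate N \<kappa> \<theta> \<alpha> \<alpha>) (fep_move N) A"
  shows "(\<lambda>x\<in>sites N. 1) \<in> A"
proof -
  interpret jump_process "configs N" "{0..int N - 1}" "fep_rate N \<kappa> \<theta> \<alpha> \<alpha>" "fep_move N"
    using assms by (intro fep_jump_process) auto
  obtain \<eta> where \<eta>: "\<eta> \<in> A" "\<And>\<xi>. \<xi> \<in> A \<Longrightarrow> vacancy_potential N \<eta> \<le> vacancy_potential N \<xi>"
    using A(2) ex_has_least_nat[of "\<lambda>\<eta>. \<eta> \<in> A" _ "vacancy_potential N"] by blast
  have "\<eta> = (\<lambda>x\<in>sites N. 1)"
  proof (rule ccontr)
    assume "\<eta> \<noteq> (\<lambda>x\<in>sites N. 1)"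
    then obtain x where x: "x \<in> {0..int N - 1}" "0 < fep_rate N \<kappa> \<theta> \<alpha> \<alpha> x \<eta>"
        "vacancy_potential N (fep_move N x \<eta>) < vacancy_potential N \<eta>"
      using vacancy_potential_decreases[of \<eta> N \<kappa> \<alpha> \<theta>] assms \<eta>(1) by blast
    moreover have "fep_move N x \<eta> \<in> A"
      using closed \<eta>(1) x unfolding closed_set_def by blast
    ultimately show False
      using \<eta>(2) by fastforce
  qed
  then show ?thesis
    using \<eta>(1) by simp
qed

section \<open>Reversibility of the Markov chain weights\<close>

lemma active_density_rho_bar: "a < 2 \<Longrightarrow> active_density (rho_bar a) = a"
  by (simp add: active_density_def rho_bar_def field_simps)

definition single_site :: "real \<Rightarrow> nat \<Rightarrow> real" where
  "single_site \<rho> i = (if i = 1 then \<rho> else 1 - \<rho>)"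

text \<open>A factorisation of the Markov chain weight over all the bonds \<open>{y, y + 1}\<close> with \<open>0 \<le> y < N\<close>, including
  those to the reservoirs: the left one carries the one-site marginal, the right one the
  trivial factor. In this way every move affects a block of consecutive bonds, with no exception at
  the boundary.\<close>

definition bond :: "nat \<Rightarrow> real \<Rightarrow> (int \<Rightarrow> nat) \<Rightarrow> int \<Rightarrow> real" where
  "bond N \<rho> \<eta> y = (if y = 0 then single_site \<rho> (\<eta> 1)
     else if y = int N - 1 then 1 else gc_transition \<rho> (\<eta> y) (\<eta> (y + 1)))"

definition weight :: "nat \<Rightarrow> real \<Rightarrow> (int \<Rightarrow> nat) \<Rightarrow> real" where
  "weight N \<rho> \<eta> = (\<Prod>y\<in>{0..int N - 1}. bond N \<rho> \<eta> y)"

text \<open>Detailed balance only concerns the factors of the bonds that a move touches.\<close>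

lemma weight_local_balance:
  assumes B: "B \<subseteq> {0..int N - 1}"
    and outside: "\<And>y. y \<in> {0..int N - 1} - B \<Longrightarrow> bond N \<rho> \<eta> y = bond N \<rho> \<xi> y"
    and inside: "(\<Prod>y\<in>B. bond N \<rho> \<eta> y) * r = (\<Prod>y\<in>B. bond N \<rho> \<xi> y) * s"
  shows "weight N \<rho> \<eta> * r = weight N \<rho> \<xi> * s"
proof -
  have split: "weight N \<rho> \<zeta> = (\<Prod>y\<in>{0..int N - 1} - B. bond N \<rho> \<zeta> y) * (\<Prod>y\<in>B. bond N \<rho> \<zeta> y)" for \<zeta>
    unfolding weight_def by (rule prod.subset_diff[OF B]) simp
  have "(\<Prod>y\<in>{0..int N - 1} - B. bond N \<rho> \<eta> y) = (\<Prod>y\<in>{0..int N - 1} - B. bond N \<rho> \<xi> y)"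
    using outside by (rule prod.cong[OF refl])
  then show ?thesis
    unfolding split using inside by (simp add: mult.assoc)
qed

text \<open>After restriction to the touched bonds this is a finite check over the occupations nearby. It uses
  that, at density \<open>rho_bar \<alpha>\<close>, the probability of a transition from \<open>1\<close> to \<open>1\<close> is \<open>\<alpha>\<close>, the same number
  that stands for the occupation of the reservoirs, and the reversibility \<open>\<rho> (1 - \<alpha>) = 1 - \<rho>\<close> of the
  two-state chain.\<close>

lemma weight_detailed_balance:
  assumes N: "N \<ge> 3" and \<alpha>: "\<alpha> < 2" and x: "x \<in> {0..int N - 1}" and \<eta>: "\<eta> \<in> configs N"
  shows "weight N (rho_bar \<alpha>) \<eta> * fep_rate N \<kappa> \<theta> \<alpha> \<alpha> x \<eta>
    = weight N (rho_bar \<alpha>) (fep_move N x \<eta>) * fep_rate N \<kappa> \<theta> \<alpha> \<alpha> x (fep_move N x \<eta>)"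
proof -
  note defs = fep_rate_def fep_move_def bond_def single_site_def gc_transition_def active_density_rho_bar[OF \<alpha>]
  have val: "\<eta> z = 0 \<or> \<eta> z = 1" if "1 \<le> z" "z < int N" for z
    using configs_values[OF \<eta>, of z] that by (simp add: sites_def)
  have rho: "rho_bar \<alpha> * (1 - \<alpha>) = 1 - rho_bar \<alpha>"
    using \<alpha> by (simp add: rho_bar_def field_simps)
  consider "x = 0" | "x = int N - 1" | "1 \<le> x" "x \<le> int N - 2"
    using x by fastforce
  then show ?thesis
  proof cases
    case 1
    have "(\<Prod>y\<in>{0, 1}. bond N (rho_bar \<alpha>) \<eta> y) * fep_rate N \<kappa> \<theta> \<alpha> \<alpha> x \<eta>
      = (\<Prod>y\<in>{0, 1}. bond N (rho_bar \<alpha>) (fep_move N x \<eta>) y) * fep_rate N \<kappa> \<theta> \<alpha> \<alpha> x (fep_move N x \<eta>)"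
      using val[of 1] val[of 2] N 1 rho
      by (auto simp: defs left_rate_def flip_def)
    then show ?thesis
      using N 1 by (intro weight_local_balance[of "{0, 1}"]) (auto simp: bond_def fep_move_def flip_def)
  next
    case 2
    have "(\<Prod>y\<in>{int N - 2, int N - 1}. bond N (rho_bar \<alpha>) \<eta> y) * fep_rate N \<kappa> \<theta> \<alpha> \<alpha> x \<eta>
      = (\<Prod>y\<in>{int N - 2, int N - 1}. bond N (rho_bar \<alpha>) (fep_move N x \<eta>) y) * fep_rate N \<kappa> \<theta> \<alpha> \<alpha> x (fep_move N x \<eta>)"
      using val[of "int N - 1"] val[of "int N - 2"] N 2
      by (auto simp: defs right_rate_def flip_def)
    then show ?thesis
      using N 2 by (intro weight_local_balance[of "{int N - 2, int N - 1}"]) (auto simp: bond_def fep_move_def flip_def)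
  next
    case 3
    have "(\<Prod>y\<in>{x - 1, x, x + 1}. bond N (rho_bar \<alpha>) \<eta> y) * fep_rate N \<kappa> \<theta> \<alpha> \<alpha> x \<eta>
      = (\<Prod>y\<in>{x - 1, x, x + 1}. bond N (rho_bar \<alpha>) (fep_move N x \<eta>) y) * fep_rate N \<kappa> \<theta> \<alpha> \<alpha> x (fep_move N x \<eta>)"
    proof (cases "x = 1"; cases "x = int N - 2")
      assume "x = 1" "x = int N - 2"
      then show ?thesis
        using val[of 1] val[of 2] N rho
        by (auto simp: defs bulk_rate_def occ_def exchange_def)
    next
      assume "x = 1" "x \<noteq> int N - 2"
      then show ?thesis
        using val[of 1] val[of 2] val[of 3] N rho 3
        by (auto simp: defs bulk_rate_def occ_def exchange_def)
    next
      assume "x \<noteq> 1" "x = int N - 2"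
      then show ?thesis
        using val[of x] val[of "x + 1"] val[of "x - 1"] N rho 3
        by (auto simp: defs bulk_rate_def occ_def exchange_def)
    next
      assume "x \<noteq> 1" "x \<noteq> int N - 2"
      then show ?thesis
        using val[of x] val[of "x + 1"] val[of "x - 1"] val[of "x + 2"] N rho 3
        by (auto simp: defs bulk_rate_def occ_def exchange_def add.commute[of 2 x])
    qed
    then show ?thesis
      using N 3 by (intro weight_local_balance[of "{x - 1, x, x + 1}"]) (auto simp: bond_def fep_move_def exchange_def)
  qed
qed

section \<open>Uniqueness of grand-canonical measures\<close>

lemma lattice_value: "\<eta> \<in> space lattice_space \<Longrightarrow> \<eta> z = 0 \<or> \<eta> z = 1"
  by (auto simp: lattice_space_def space_PiM PiE_iff)

lemma lattice_spaceI: "(\<And>z. \<eta> z = 0 \<or> \<eta> z = 1) \<Longrightarrow> \<eta> \<in> space lattice_space"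
  by (auto simp: lattice_space_def space_PiM PiE_iff)

lemma measurable_cylinder:
  assumes "sets M = sets lattice_space" "finite I"
  shows "{\<eta> \<in> space M. \<forall>z\<in>I. \<eta> z = \<sigma> z} \<in> sets M"
proof -
  have "{\<eta> \<in> space lattice_space. \<forall>z\<in>I. \<eta> z = \<sigma> z} \<in> sets lattice_space"
  proof (rule sets.sets_Collect_finite_All[OF _ assms(2)])
    fix z assume "z \<in> I"
    have "(\<lambda>\<eta>. \<eta> z) -` ({\<sigma> z} \<inter> {0, 1}) \<inter> space lattice_space \<in> sets lattice_space"
      unfolding lattice_space_def by (rule measurable_sets[OF measurable_component_singleton]) auto
    moreover have "(\<lambda>\<eta>. \<eta> z) -` ({\<sigma> z} \<inter> {0, 1}) \<inter> space lattice_space = {\<eta> \<in> space lattice_space. \<eta> z = \<sigma> z}"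
      using lattice_value[of _ z] by fastforce
    ultimately show "{\<eta> \<in> space lattice_space. \<eta> z = \<sigma> z} \<in> sets lattice_space"
      by simp
  qed
  then show ?thesis
    using assms(1) sets_eq_imp_space_eq[OF assms(1)] by simp
qed

lemma measurable_restriction:
  assumes "sets M = sets lattice_space" "finite I"
  shows "{\<eta> \<in> space M. restrict \<eta> I = \<tau>} \<in> sets M"
proof (cases "\<tau> \<in> extensional I")
  case True
  then have "{\<eta> \<in> space M. restrict \<eta> I = \<tau>} = {\<eta> \<in> space M. \<forall>z\<in>I. \<eta> z = \<tau> z}"
    by (auto simp: fun_eq_iff extensional_def)
  then show ?thesis
    using measurable_cylinder[OF assms] by simp
next
  case False
  then have "restrict \<eta> I \<noteq> \<tau>" for \<eta> :: "int \<Rightarrow> nat"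
    using restrict_extensional by metis
  then show ?thesis by simp
qed

text \<open>An event that depends only on the sites in \<open>I\<close> is a disjoint union of the finitely many cylinders
  over \<open>I\<close>.\<close>

lemma measure_eq_sum_restrictions:
  assumes "finite_measure M" and sets: "sets M = sets lattice_space"
    and B: "B = {\<eta> \<in> space M. restrict \<eta> I \<in> T}" and I: "finite I" and T: "T \<subseteq> I \<rightarrow>\<^sub>E {0, 1}"
  shows "measure M B = (\<Sum>\<tau>\<in>T. measure M {\<eta> \<in> space M. restrict \<eta> I = \<tau>})"
proof -
  interpret finite_measure M by fact
  have "finite T"
    using T finite_PiE[OF I, of "\<lambda>_. {0, 1 :: nat}"] by (auto intro: finite_subset)
  moreover have "B = (\<Union>\<tau>\<in>T. {\<eta> \<in> space M. restrict \<eta> I = \<tau>})"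
    using B by auto
  ultimately show ?thesis
    using measurable_restriction[OF sets I]
    by (simp only:) (intro finite_measure_finite_Union, auto simp: disjoint_family_on_def)
qed

lemma grand_canonical_cylinder:
  assumes gc: "is_grand_canonical \<rho> M" and "x \<le> y" and \<sigma>: "\<sigma> \<in> UNIV \<rightarrow> {0, 1}"
  shows "measure M {\<eta> \<in> space M. \<forall>z\<in>{x..y}. \<eta> z = \<sigma> z}
    = single_site \<rho> (\<sigma> x) * (\<Prod>z\<in>{x..<y}. gc_transition \<rho> (\<sigma> z) (\<sigma> (z + 1)))"
  using \<open>x \<le> y\<close>
proof (induction y rule: int_ge_induct)
  case base
  interpret prob_space M
    using gc by (simp add: is_grand_canonical_def)
  have sets: "sets M = sets lattice_space" and one: "measure M {\<eta> \<in> space M. \<eta> x = 1} = \<rho>"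
    using gc by (auto simp: is_grand_canonical_def)
  have vals: "\<eta> x = 0 \<longleftrightarrow> \<eta> x \<noteq> 1" if "\<eta> \<in> space M" for \<eta>
    using lattice_value[of \<eta> x] that sets_eq_imp_space_eq[OF sets] by auto
  have event: "{\<eta> \<in> space M. \<eta> x = 1} \<in> sets M"
    using measurable_cylinder[OF sets, of "{x}" "\<lambda>_. 1"] by simp
  show ?case
  proof (cases "\<sigma> x = 1")
    case True
    then show ?thesis
      using one by (simp add: single_site_def)
  next
    case False
    then have "\<sigma> x = 0"
      using \<sigma> by (auto simp: Pi_iff)
    then have "{\<eta> \<in> space M. \<forall>z\<in>{x..x}. \<eta> z = \<sigma> z} = space M - {\<eta> \<in> space M. \<eta> x = 1}"
      using vals by auto
    then have "measure M {\<eta> \<in> space M. \<forall>z\<in>{x..x}. \<eta> z = \<sigma> z} = 1 - \<rho>"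
      using prob_compl[OF event] one by simp
    then show ?thesis
      using \<open>\<sigma> x = 0\<close> by (simp add: single_site_def)
  qed
next
  case (step y)
  have "{x..<y + 1} = insert y {x..<y}"
    using step.hyps by auto
  then show ?case
    using gc step \<sigma> by (simp add: is_grand_canonical_def)
qed

lemma grand_canonical_restriction:
  assumes gc: "is_grand_canonical \<rho> M" and "x \<le> y" and \<tau>: "\<tau> \<in> {x..y} \<rightarrow>\<^sub>E {0, 1}"
  shows "measure M {\<eta> \<in> space M. restrict \<eta> {x..y} = \<tau>}
    = single_site \<rho> (\<tau> x) * (\<Prod>z\<in>{x..<y}. gc_transition \<rho> (\<tau> z) (\<tau> (z + 1)))"
proof -
  define \<sigma> where "\<sigma> z = (if z \<in> {x..y} then \<tau> z else 0)" for z
  have "\<sigma> \<in> UNIV \<rightarrow> {0, 1}"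
    using \<tau> by (auto simp: \<sigma>_def PiE_iff)
  from grand_canonical_cylinder[OF gc \<open>x \<le> y\<close> this]
  have "measure M {\<eta> \<in> space M. \<forall>z\<in>{x..y}. \<eta> z = \<sigma> z}
      = single_site \<rho> (\<tau> x) * (\<Prod>z\<in>{x..<y}. gc_transition \<rho> (\<sigma> z) (\<sigma> (z + 1)))"
    using \<open>x \<le> y\<close> by (simp add: \<sigma>_def)
  also have "(\<Prod>z\<in>{x..<y}. gc_transition \<rho> (\<sigma> z) (\<sigma> (z + 1))) = (\<Prod>z\<in>{x..<y}. gc_transition \<rho> (\<tau> z) (\<tau> (z + 1)))"
    by (rule prod.cong) (auto simp: \<sigma>_def)
  also have "{\<eta> \<in> space M. \<forall>z\<in>{x..y}. \<eta> z = \<sigma> z} = {\<eta> \<in> space M. restrict \<eta> {x..y} = \<tau>}"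
    using \<tau> by (auto simp: \<sigma>_def fun_eq_iff PiE_iff extensional_def restrict_def)
  finally show ?thesis .
qed

lemma grand_canonical_unique:
  assumes M: "is_grand_canonical \<rho> M" and M': "is_grand_canonical \<rho> M'"
  shows "M = M'"
proof -
  interpret M: prob_space M
    using M by (simp add: is_grand_canonical_def)
  interpret M': prob_space M'
    using M' by (simp add: is_grand_canonical_def)
  have sets: "sets M = sets lattice_space" "sets M' = sets lattice_space"
    using M M' by (auto simp: is_grand_canonical_def)
  show ?thesis
  proof (rule measure_eqI_PiM_infinite)
    show "sets M = sets (\<Pi>\<^sub>M x\<in>(UNIV :: int set). count_space {0, 1 :: nat})"
        "sets M' = sets (\<Pi>\<^sub>M x\<in>(UNIV :: int set). count_space {0, 1 :: nat})"
      using sets by (simp_all add: lattice_space_def)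
    show "finite_measure M"
      by (rule M.finite_measure_axioms)
    fix A :: "int \<Rightarrow> nat set" and J :: "int set"
    assume "finite J"
    \<comment> \<open>The window \<open>{- m..m}\<close> contains \<open>J\<close>, so the event is a finite union of cylinders over the window.\<close>
    define m where "m = Max (abs ` insert 0 J)"
    have "\<bar>z\<bar> \<le> m" if "z \<in> insert 0 J" for z
      unfolding m_def using \<open>finite J\<close> that by (intro Max_ge) auto
    then have J: "J \<subseteq> {- m..m}" and "- m \<le> m"
      by force+
    let ?B = "prod_emb UNIV (\<lambda>_. count_space {0, 1 :: nat}) J (Pi\<^sub>E J A)"
    define T where "T = {\<tau> \<in> {- m..m} \<rightarrow>\<^sub>E {0, 1}. \<forall>z\<in>J. \<tau> z \<in> A z}"
    have "restrict \<eta> {- m..m} \<in> T \<longleftrightarrow> (\<forall>z\<in>J. \<eta> z \<in> A z)" if "\<eta> \<in> space lattice_space" for \<eta>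
      using lattice_value[OF that] J by (auto simp: T_def restrict_PiE_iff subset_iff)
    moreover have "?B = {\<eta> \<in> space lattice_space. \<forall>z\<in>J. \<eta> z \<in> A z}"
      by (auto simp: prod_emb_def lattice_space_def space_PiM restrict_PiE_iff)
    ultimately have B: "?B = {\<eta> \<in> space lattice_space. restrict \<eta> {- m..m} \<in> T}"
      by blast
    have law: "measure K ?B = (\<Sum>\<tau>\<in>T. single_site \<rho> (\<tau> (- m)) *
        (\<Prod>z\<in>{- m..<m}. gc_transition \<rho> (\<tau> z) (\<tau> (z + 1))))"
      if K: "is_grand_canonical \<rho> K" for K
    proof -
      have "finite_measure K" and sets_K: "sets K = sets lattice_space"
        using K by (auto simp: is_grand_canonical_def prob_space_def)
      moreover have "?B = {\<eta> \<in> space K. restrict \<eta> {- m..m} \<in> T}"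
        using B sets_eq_imp_space_eq[OF sets_K] by simp
      ultimately have "measure K ?B = (\<Sum>\<tau>\<in>T. measure K {\<eta> \<in> space K. restrict \<eta> {- m..m} = \<tau>})"
        by (rule measure_eq_sum_restrictions) (auto simp: T_def)
      also have "\<dots> = (\<Sum>\<tau>\<in>T. single_site \<rho> (\<tau> (- m)) *
        (\<Prod>z\<in>{- m..<m}. gc_transition \<rho> (\<tau> z) (\<tau> (z + 1))))"
        using grand_canonical_restriction[OF K \<open>- m \<le> m\<close>] by (intro sum.cong) (auto simp: T_def)
      finally show ?thesis .
    qed
    from law[OF M] law[OF M'] have "measure M ?B = measure M' ?B"
      by (rule trans[OF _ sym])
    then show "emeasure M ?B = emeasure M' ?B"
      by (simp add: M.emeasure_eq_measure M'.emeasure_eq_measure)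
  qed
qed

section \<open>Existence of grand-canonical measures\<close>

text \<open>The product measure is the image of \<open>B \<Otimes> Q\<close>, with \<open>Q\<close> the product over the other coordinates, under the
  map that inserts coordinate \<open>i\<close>. The event \<open>E\<close> does not see this coordinate, so the preimage of the
  joint event is a rectangle \<open>A \<times> C\<close>.\<close>

lemma measure_PiM_independent_coordinate:
  fixes B :: "'b measure" and i :: 'i
  defines "P \<equiv> \<Pi>\<^sub>M i\<in>(UNIV :: 'i set). B"
  assumes "prob_space B" and E: "E \<in> sets P" and A: "A \<in> sets B"
    and insensitive: "\<And>\<xi> v. \<xi> \<in> space P \<Longrightarrow> v \<in> space B \<Longrightarrow> \<xi>(i := v) \<in> E \<longleftrightarrow> \<xi> \<in> E"
  shows "measure P {\<xi> \<in> E. \<xi> i \<in> A} = measure B A * measure P E"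
proof -
  interpret B: prob_space B by fact
  define Q where "Q = (\<Pi>\<^sub>M i\<in>UNIV - {i}. B)"
  interpret Q: prob_space Q
    unfolding Q_def by (rule prob_space_PiM) (rule B.prob_space_axioms)
  interpret P: prob_space P
    unfolding P_def by (rule prob_space_PiM) (rule B.prob_space_axioms)
  let ?glue = "\<lambda>(v, X). X(i := v)"
  have P_glue: "distr (B \<Otimes>\<^sub>M Q) P ?glue = P"
    using distr_pair_PiM_eq_PiM[of "UNIV - {i}" "\<lambda>_. B" i] B.prob_space_axioms
    by (simp add: P_def Q_def insert_absorb)
  have upd: "(\<lambda>z. (snd z)(i := fst z)) \<in> measurable (B \<Otimes>\<^sub>M Q) P"
    unfolding P_def
  proof (rule measurable_PiM_single')
    fix j
    show "(\<lambda>z. ((snd z)(i := fst z)) j) \<in> measurable (B \<Otimes>\<^sub>M Q) B"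
    proof (cases "j = i")
      case False
      then have "(\<lambda>X. X j) \<in> measurable Q B"
        unfolding Q_def by (intro measurable_component_singleton) simp
      with False show ?thesis
        using measurable_compose[OF measurable_snd] by simp
    qed simp
  next
    show "(\<lambda>z. (snd z)(i := fst z)) \<in> space (B \<Otimes>\<^sub>M Q) \<rightarrow> (\<Pi>\<^sub>E i\<in>UNIV. space B)"
      unfolding Q_def space_pair_measure space_PiM PiE_UNIV_domain
      by (fastforce simp: PiE_iff)
  qed
  then have glue: "?glue \<in> measurable (B \<Otimes>\<^sub>M Q) P"
    by (simp add: case_prod_beta')
  obtain v0 where v0: "v0 \<in> space B"
    using B.not_empty by auto
  define C where "C = {X \<in> space Q. X(i := v0) \<in> E}"
  have "(\<lambda>X. X(i := v0)) \<in> measurable Q P"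
    using measurable_compose[OF measurable_Pair1'[OF v0] glue] by simp
  from measurable_sets[OF this E] have C: "C \<in> sets Q"
    by (simp add: C_def vimage_def Int_def conj_commute)
  have upd_space: "X(i := v) \<in> space P" if "X \<in> space Q" "v \<in> space B" for X v
    using measurable_space[OF glue, of "(v, X)"] that by (simp add: space_pair_measure)
  have EC: "X(i := v) \<in> E \<longleftrightarrow> X \<in> C" if "X \<in> space Q" "v \<in> space B" for X v
    using insensitive[OF upd_space[OF that(1) v0] that(2)] that by (simp add: C_def)
  have val: "measure P {\<xi> \<in> E. \<xi> i \<in> A'} = measure B A' * measure Q C" if A': "A' \<in> sets B" for A'
  proof -
    have ev: "{\<xi> \<in> E. \<xi> i \<in> A'} \<in> sets P"
    proof -
      have "(\<lambda>\<xi>. \<xi> i) -` A' \<inter> space P \<in> sets P"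
        unfolding P_def using A' by (intro measurable_sets[OF measurable_component_singleton]) auto
      from sets.Int[OF E this] have "E \<inter> ((\<lambda>\<xi>. \<xi> i) -` A' \<inter> space P) \<in> sets P" .
      moreover have "E \<inter> ((\<lambda>\<xi>. \<xi> i) -` A' \<inter> space P) = {\<xi> \<in> E. \<xi> i \<in> A'}"
        using sets.sets_into_space[OF E] by auto
      ultimately show ?thesis by simp
    qed
    have "emeasure P {\<xi> \<in> E. \<xi> i \<in> A'} = emeasure (distr (B \<Otimes>\<^sub>M Q) P ?glue) {\<xi> \<in> E. \<xi> i \<in> A'}"
      by (simp add: P_glue)
    also have "\<dots> = emeasure (B \<Otimes>\<^sub>M Q) (?glue -` {\<xi> \<in> E. \<xi> i \<in> A'} \<inter> space (B \<Otimes>\<^sub>M Q))"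
      by (rule emeasure_distr[OF glue ev])
    also have "?glue -` {\<xi> \<in> E. \<xi> i \<in> A'} \<inter> space (B \<Otimes>\<^sub>M Q) = A' \<times> C"
      using EC sets.sets_into_space[OF A'] sets.sets_into_space[OF C]
      by (auto simp: space_pair_measure subset_iff)
    also have "emeasure (B \<Otimes>\<^sub>M Q) (A' \<times> C) = emeasure B A' * emeasure Q C"
      by (rule Q.emeasure_pair_measure_Times[OF A' C])
    finally show ?thesis
      by (simp add: measure_def enn2real_mult)
  qed
  have "{\<xi> \<in> E. \<xi> i \<in> space B} = E"
    using sets.sets_into_space[OF E] by (auto simp: P_def space_PiM PiE_iff)
  with val[OF sets.top] have "measure P E = measure Q C"
    by (simp add: B.prob_space)
  with val[OF A] show ?thesis by simp
qed

text \<open>The run of true tosses that ends at \<open>x\<close> has odd length. When this run is infinite the site counts as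
  occupied; this is a null event, and the choice is invariant under translations.\<close>

definition vacant :: "(int \<Rightarrow> bool) \<Rightarrow> int \<Rightarrow> bool" where
  "vacant \<xi> x \<longleftrightarrow> (\<exists>n. odd n \<and> (\<forall>k<n. \<xi> (x - int k)) \<and> \<not> \<xi> (x - int n))"

definition occupation_field :: "(int \<Rightarrow> bool) \<Rightarrow> int \<Rightarrow> nat" where
  "occupation_field \<xi> x = (if vacant \<xi> x then 0 else 1)"

text \<open>The run that ends at \<open>x + 1\<close> is empty, or one longer than the run that ends at \<open>x\<close>. If all tosses
  up to \<open>x + 1\<close> are true, neither site counts as empty and the equivalence fails.\<close>

lemma vacant_step:
  assumes "\<exists>n. \<not> \<xi> (x - int n)"
  shows "vacant \<xi> (x + 1) \<longleftrightarrow> \<xi> (x + 1) \<and> \<not> vacant \<xi> x"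
proof -
  define L where "L = (LEAST n. \<not> \<xi> (x - int n))"
  have L: "\<not> \<xi> (x - int L)" "\<And>k. k < L \<Longrightarrow> \<xi> (x - int k)"
    using LeastI_ex[OF assms] not_less_Least unfolding L_def by auto
  have run: "(\<forall>k<n. \<xi> (x - int k)) \<and> \<not> \<xi> (x - int n) \<longleftrightarrow> n = L" for n
    by (cases n L rule: linorder_cases) (use L in auto)
  have "vacant \<xi> (x + 1) \<longleftrightarrow> (\<exists>n. odd (Suc n) \<and> (\<forall>k<Suc n. \<xi> (x + 1 - int k)) \<and> \<not> \<xi> (x + 1 - int (Suc n)))"
    (is "_ \<longleftrightarrow> (\<exists>n. ?run (Suc n))")
  proof
    assume "vacant \<xi> (x + 1)"
    then obtain n where n: "?run n"
      unfolding vacant_def by blast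
    then obtain m where "n = Suc m"
      by (cases n) auto
    with n show "\<exists>n. ?run (Suc n)"
      by blast
  next
    assume "\<exists>n. ?run (Suc n)"
    then show "vacant \<xi> (x + 1)"
      unfolding vacant_def by blast
  qed
  also have "\<dots> \<longleftrightarrow> (\<exists>n. even n \<and> \<xi> (x + 1) \<and> (\<forall>k<n. \<xi> (x - int k)) \<and> \<not> \<xi> (x - int n))"
    by (simp add: All_less_Suc2)
  also have "\<dots> \<longleftrightarrow> \<xi> (x + 1) \<and> even L"
    using run by auto
  also have "even L \<longleftrightarrow> \<not> vacant \<xi> x"
    unfolding vacant_def using run by auto
  finally show ?thesis .
qed

lemma vacant_shift: "vacant (\<lambda>z. \<xi> (z + 1)) x \<longleftrightarrow> vacant \<xi> (x + 1)"
  by (simp add: vacant_def algebra_simps)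

lemma vacant_cong: "(\<And>z. z \<le> x \<Longrightarrow> \<xi> z = \<xi>' z) \<Longrightarrow> vacant \<xi> x = vacant \<xi>' x"
  unfolding vacant_def by (intro arg_cong[of _ _ Ex] ext) auto

lemma occupation_field_in_space: "occupation_field \<xi> \<in> space lattice_space"
  by (rule lattice_spaceI) (simp add: occupation_field_def)

text \<open>A toss is true with probability \<open>1 - a\<close>, the probability of a transition from \<open>1\<close> to \<open>0\<close>.\<close>

definition noise :: "real \<Rightarrow> (int \<Rightarrow> bool) measure" where
  "noise a = (\<Pi>\<^sub>M i\<in>(UNIV :: int set). measure_pmf (bernoulli_pmf (1 - a)))"

lemma prob_space_noise: "prob_space (noise a)"
  unfolding noise_def by (rule prob_space_PiM) (rule measure_pmf.prob_space_axioms)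

lemma space_noise: "space (noise a) = UNIV"
  by (simp add: noise_def space_PiM PiE_UNIV_domain)

lemma measurable_noise_coordinate[measurable]: "Measurable.pred (noise a) (\<lambda>\<xi>. \<xi> z)"
proof -
  have "(\<lambda>\<xi>. \<xi> z) \<in> measurable (noise a) (measure_pmf (bernoulli_pmf (1 - a)))"
    unfolding noise_def by (rule measurable_component_singleton) simp
  then show ?thesis
    by (simp add: measurable_def)
qed

lemma measurable_vacant[measurable]: "Measurable.pred (noise a) (\<lambda>\<xi>. vacant \<xi> x)"
  unfolding vacant_def by measurable

lemma sets_noise_iff: "{\<xi>. R \<xi>} \<in> sets (noise a) \<longleftrightarrow> Measurable.pred (noise a) R"
  by (simp add: pred_def space_noise)

lemma measurable_occupation_field: "occupation_field \<in> measurable (noise a) lattice_space"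
proof -
  have "(\<lambda>\<xi>. occupation_field \<xi> x) \<in> measurable (noise a) (count_space {0, 1})" for x
    unfolding occupation_field_def by measurable
  then show ?thesis
    unfolding lattice_space_def
    by (intro measurable_PiM_single'[of UNIV "\<lambda>x \<xi>. occupation_field \<xi> x" "noise a" "\<lambda>_. count_space {0, 1}"])
      (auto simp: occupation_field_def)
qed

lemma measurable_noise_shift: "(\<lambda>\<xi> x. \<xi> (x + 1)) \<in> measurable (noise a) (noise a)"
  unfolding noise_def
  by (rule measurable_PiM_single', rule measurable_component_singleton) (simp_all add: space_PiM PiE_UNIV_domain)

lemma noise_shift: "distr (noise a) (noise a) (\<lambda>\<xi> x. \<xi> (x + 1)) = noise a"
  using distr_PiM_reindex[of UNIV "\<lambda>_. measure_pmf (bernoulli_pmf (1 - a))" "\<lambda>x :: int. x + 1" UNIV]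
    measure_pmf.prob_space_axioms[of "bernoulli_pmf (1 - a)"]
  by (simp add: noise_def inj_on_def restrict_UNIV)

lemma noise_independent_coordinate:
  assumes "0 \<le> a" "a \<le> 1" "Measurable.pred (noise a) R" "\<And>\<xi> v. R (\<xi>(i := v)) = R \<xi>"
  shows "measure (noise a) {\<xi>. R \<xi> \<and> \<xi> i} = (1 - a) * measure (noise a) {\<xi>. R \<xi>}"
  using measure_PiM_independent_coordinate[of "measure_pmf (bernoulli_pmf (1 - a))" "{\<xi>. R \<xi>}" "{True}" i] assms
    measure_pmf.prob_space_axioms[of "bernoulli_pmf (1 - a)"]
  by (simp add: noise_def[symmetric] sets_noise_iff measure_pmf_single)

text \<open>A run of length at least \<open>n\<close> has probability \<open>(1 - a) ^ n\<close>, which tends to \<open>0\<close>.\<close>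

lemma noise_run_interrupted:
  assumes "0 < a" "a \<le> 1"
  shows "AE \<xi> in noise a. \<exists>n. \<not> \<xi> (x - int n)"
proof -
  interpret prob_space "noise a"
    by (rule prob_space_noise)
  define N where "N = {\<xi>. \<forall>n. \<xi> (x - int n)}"
  have N: "N \<in> sets (noise a)"
    unfolding N_def sets_noise_iff by measurable
  have "measure (noise a) N \<le> measure (noise a) {\<xi>. \<forall>k<n. \<xi> (x - int k)}" for n
    by (intro finite_measure_mono) (auto simp: N_def sets_noise_iff)
  moreover have "measure (noise a) {\<xi>. \<forall>k<n. \<xi> (x - int k)} = (1 - a) ^ n" for n
  proof (induction n)
    case 0
    then show ?case
      using prob_space by (simp add: space_noise)
  next
    case (Suc n)
    have "measure (noise a) {\<xi>. (\<forall>k<n. \<xi> (x - int k)) \<and> \<xi> (x - int n)}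
        = (1 - a) * measure (noise a) {\<xi>. \<forall>k<n. \<xi> (x - int k)}"
      using assms by (intro noise_independent_coordinate) auto
    then show ?case
      using Suc by (simp add: All_less_Suc conj_commute)
  qed
  ultimately have "measure (noise a) N \<le> (1 - a) ^ n" for n
    by metis
  moreover have "(\<lambda>n. (1 - a) ^ n) \<longlonglongrightarrow> 0"
    using assms by (intro LIMSEQ_power_zero) auto
  ultimately have "measure (noise a) N \<le> 0"
    by (intro LIMSEQ_le_const) auto
  then have "N \<in> null_sets (noise a)"
    using N by (intro null_setsI) (auto simp: emeasure_eq_measure measure_le_0_iff)
  then show ?thesis
    by (rule AE_I') (auto simp: N_def)
qed

text \<open>Up to a null event, \<open>x + 1\<close> is empty iff \<open>x\<close> is occupied and the toss at \<open>x + 1\<close> is true, and this toss is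
  independent of everything up to \<open>x\<close>. Both the density and the Markov property of the field follow
  from this identity.\<close>

lemma noise_vacant_step:
  assumes "0 < a" "a \<le> 1" and R[measurable]: "Measurable.pred (noise a) R"
    and past: "\<And>\<xi> \<xi>'. (\<And>z. z \<le> x \<Longrightarrow> \<xi> z = \<xi>' z) \<Longrightarrow> R \<xi> = R \<xi>'"
  shows "measure (noise a) {\<xi>. R \<xi> \<and> vacant \<xi> (x + 1)}
    = (1 - a) * measure (noise a) {\<xi>. R \<xi> \<and> \<not> vacant \<xi> x}"
proof -
  interpret prob_space "noise a"
    by (rule prob_space_noise)
  have "measure (noise a) {\<xi>. R \<xi> \<and> vacant \<xi> (x + 1)}
      = measure (noise a) {\<xi>. (R \<xi> \<and> \<not> vacant \<xi> x) \<and> \<xi> (x + 1)}"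
  proof (rule finite_measure_eq_AE)
    show "AE \<xi> in noise a. \<xi> \<in> {\<xi>. R \<xi> \<and> vacant \<xi> (x + 1)}
        \<longleftrightarrow> \<xi> \<in> {\<xi>. (R \<xi> \<and> \<not> vacant \<xi> x) \<and> \<xi> (x + 1)}"
      using noise_run_interrupted[OF assms(1,2), of x]
      by eventually_elim (auto simp: vacant_step)
  qed (unfold sets_noise_iff, measurable)
  also have "\<dots> = (1 - a) * measure (noise a) {\<xi>. R \<xi> \<and> \<not> vacant \<xi> x}"
  proof (rule noise_independent_coordinate)
    show "(R (\<xi>(x + 1 := v)) \<and> \<not> vacant (\<xi>(x + 1 := v)) x) = (R \<xi> \<and> \<not> vacant \<xi> x)" for \<xi> v
      using past[of "\<xi>(x + 1 := v)" \<xi>] vacant_cong[of x "\<xi>(x + 1 := v)" \<xi>] by simp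
  qed (use assms(1,2) in \<open>auto\<close>)
  finally show ?thesis .
qed

definition chain_law :: "real \<Rightarrow> (int \<Rightarrow> nat) measure" where
  "chain_law a = distr (noise a) lattice_space occupation_field"

lemma sets_chain_law: "sets (chain_law a) = sets lattice_space"
  by (simp add: chain_law_def)

lemma chain_law_cylinder:
  assumes "finite I"
  shows "Measurable.pred (noise a) (\<lambda>\<xi>. \<forall>z\<in>I. occupation_field \<xi> z = \<sigma> z)"
    and "measure (chain_law a) {\<eta> \<in> space (chain_law a). \<forall>z\<in>I. \<eta> z = \<sigma> z}
      = measure (noise a) {\<xi>. \<forall>z\<in>I. occupation_field \<xi> z = \<sigma> z}"
proof -
  let ?C = "{\<eta> \<in> space (chain_law a). \<forall>z\<in>I. \<eta> z = \<sigma> z}"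
  have C: "?C \<in> sets lattice_space"
    using measurable_cylinder[OF sets_chain_law assms] sets_chain_law by blast
  have preimage: "occupation_field -` ?C \<inter> space (noise a) = {\<xi>. \<forall>z\<in>I. occupation_field \<xi> z = \<sigma> z}"
    by (auto simp: space_noise chain_law_def occupation_field_in_space)
  show "Measurable.pred (noise a) (\<lambda>\<xi>. \<forall>z\<in>I. occupation_field \<xi> z = \<sigma> z)"
    using measurable_sets[OF measurable_occupation_field C, of a]
    unfolding preimage sets_noise_iff .
  show "measure (chain_law a) ?C = measure (noise a) {\<xi>. \<forall>z\<in>I. occupation_field \<xi> z = \<sigma> z}"
    using measure_distr[OF measurable_occupation_field C, of a]
    unfolding preimage chain_law_def[symmetric] .
qed

lemma chain_law_shift: "distr (chain_law a) (chain_law a) (\<lambda>\<eta> x. \<eta> (x + 1)) = chain_law a"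
proof -
  have shift: "(\<lambda>\<eta> x. \<eta> (x + 1)) \<in> measurable lattice_space lattice_space"
    unfolding lattice_space_def by (rule measurable_PiM_single') (auto simp: space_PiM PiE_iff)
  have "distr (chain_law a) (chain_law a) (\<lambda>\<eta> x. \<eta> (x + 1)) = distr (chain_law a) lattice_space (\<lambda>\<eta> x. \<eta> (x + 1))"
    by (rule distr_cong) (auto simp: sets_chain_law)
  also have "\<dots> = distr (noise a) lattice_space ((\<lambda>\<eta> x. \<eta> (x + 1)) \<circ> occupation_field)"
    unfolding chain_law_def by (rule distr_distr[OF shift measurable_occupation_field])
  also have "(\<lambda>\<eta> x. \<eta> (x + 1)) \<circ> occupation_field = occupation_field \<circ> (\<lambda>\<xi> x. \<xi> (x + 1))"
    by (auto simp: fun_eq_iff occupation_field_def vacant_shift)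
  also have "distr (noise a) lattice_space (occupation_field \<circ> (\<lambda>\<xi> x. \<xi> (x + 1)))
      = distr (distr (noise a) (noise a) (\<lambda>\<xi> x. \<xi> (x + 1))) lattice_space occupation_field"
    by (rule distr_distr[OF measurable_occupation_field measurable_noise_shift, symmetric])
  finally show ?thesis
    by (simp add: noise_shift chain_law_def)
qed

text \<open>By stationarity the density \<open>p\<close> solves \<open>1 - p = (1 - a) p\<close>.\<close>

lemma chain_law_density:
  assumes "0 < a" "a \<le> 1"
  shows "measure (chain_law a) {\<eta> \<in> space (chain_law a). \<eta> x = 1} = rho_bar a"
proof -
  interpret prob_space "noise a"
    by (rule prob_space_noise)
  define p where "p y = measure (noise a) {\<xi>. \<not> vacant \<xi> y}" for y
  have event: "{\<xi>. \<not> vacant \<xi> y} \<in> sets (noise a)" for y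
    unfolding sets_noise_iff by measurable
  have "p x = measure (distr (noise a) (noise a) (\<lambda>\<xi> x. \<xi> (x + 1))) {\<xi>. \<not> vacant \<xi> x}"
    by (simp add: noise_shift p_def)
  also have "\<dots> = p (x + 1)"
    by (subst measure_distr[OF measurable_noise_shift event]) (simp add: space_noise p_def vacant_shift)
  finally have "p (x + 1) = p x"
    by simp
  moreover have "1 - p (x + 1) = (1 - a) * p x"
  proof -
    have "space (noise a) - {\<xi>. \<not> vacant \<xi> (x + 1)} = {\<xi>. True \<and> vacant \<xi> (x + 1)}"
      by (auto simp: space_noise)
    then have "1 - p (x + 1) = measure (noise a) {\<xi>. True \<and> vacant \<xi> (x + 1)}"
      using prob_compl[OF event[of "x + 1"]] by (simp add: p_def)
    also have "\<dots> = (1 - a) * p x"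
      unfolding p_def using noise_vacant_step[OF assms, of "\<lambda>_. True" x] by simp
    finally show ?thesis .
  qed
  ultimately have "p x = rho_bar a"
    using assms by (simp add: rho_bar_def field_simps)
  moreover have "{\<xi>. occupation_field \<xi> x = 1} = {\<xi>. \<not> vacant \<xi> x}"
    by (auto simp: occupation_field_def)
  ultimately show ?thesis
    using chain_law_cylinder(2)[of "{x}" a "\<lambda>_. 1"] by (simp add: p_def)
qed

lemma chain_law_markov:
  assumes "0 < a" "a \<le> 1" "x \<le> y" and \<sigma>: "\<sigma> \<in> UNIV \<rightarrow> {0, 1}"
  shows "measure (chain_law a) {\<eta> \<in> space (chain_law a). \<forall>z\<in>{x..y + 1}. \<eta> z = \<sigma> z}
    = measure (chain_law a) {\<eta> \<in> space (chain_law a). \<forall>z\<in>{x..y}. \<eta> z = \<sigma> z}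
      * gc_transition (rho_bar a) (\<sigma> y) (\<sigma> (y + 1))"
proof -
  interpret prob_space "noise a"
    by (rule prob_space_noise)
  define R where "R \<xi> \<longleftrightarrow> (\<forall>z\<in>{x..y}. occupation_field \<xi> z = \<sigma> z)" for \<xi>
  have R[measurable]: "Measurable.pred (noise a) R"
    unfolding R_def[abs_def] by (rule chain_law_cylinder) simp
  have past: "R \<xi> = R \<xi>'" if "\<And>z. z \<le> y \<Longrightarrow> \<xi> z = \<xi>' z" for \<xi> \<xi>'
  proof -
    have "vacant \<xi> z = vacant \<xi>' z" if "z \<le> y" for z
      using that \<open>\<And>z. z \<le> y \<Longrightarrow> \<xi> z = \<xi>' z\<close> by (intro vacant_cong) auto
    then show ?thesis
      by (auto simp: R_def occupation_field_def)
  qed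
  have current: "\<not> vacant \<xi> y \<longleftrightarrow> \<sigma> y = 1" if "R \<xi>" for \<xi>
  proof -
    have "occupation_field \<xi> y = \<sigma> y"
      using that \<open>x \<le> y\<close> by (simp add: R_def)
    then show ?thesis
      by (auto simp: occupation_field_def split: if_splits)
  qed
  \<comment> \<open>From an empty site there is no transition to an empty site.\<close>
  have to_vacant: "measure (noise a) {\<xi>. R \<xi> \<and> vacant \<xi> (y + 1)}
      = measure (noise a) {\<xi>. R \<xi>} * (if \<sigma> y = 1 then 1 - a else 0)"
  proof -
    have "{\<xi>. R \<xi> \<and> \<not> vacant \<xi> y} = (if \<sigma> y = 1 then {\<xi>. R \<xi>} else {})"
      using current by auto
    then show ?thesis
      using noise_vacant_step[OF assms(1,2) R past] by simp
  qed
  have to_occupied: "measure (noise a) {\<xi>. R \<xi> \<and> \<not> vacant \<xi> (y + 1)}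
      = measure (noise a) {\<xi>. R \<xi>} - measure (noise a) {\<xi>. R \<xi> \<and> vacant \<xi> (y + 1)}"
  proof -
    have "{\<xi>. R \<xi>} \<in> sets (noise a)" "{\<xi>. R \<xi> \<and> vacant \<xi> (y + 1)} \<in> sets (noise a)"
      unfolding sets_noise_iff by measurable
    then have "measure (noise a) ({\<xi>. R \<xi>} - {\<xi>. R \<xi> \<and> vacant \<xi> (y + 1)})
        = measure (noise a) {\<xi>. R \<xi>} - measure (noise a) {\<xi>. R \<xi> \<and> vacant \<xi> (y + 1)}"
      by (intro finite_measure_Diff) auto
    moreover have "{\<xi>. R \<xi>} - {\<xi>. R \<xi> \<and> vacant \<xi> (y + 1)} = {\<xi>. R \<xi> \<and> \<not> vacant \<xi> (y + 1)}"
      by auto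
    ultimately show ?thesis by simp
  qed
  have split: "{x..y + 1} = insert (y + 1) {x..y}"
    using \<open>x \<le> y\<close> by auto
  have "\<sigma> (y + 1) = 0 \<or> \<sigma> (y + 1) = 1"
    using \<sigma> by (auto simp: Pi_iff)
  then have "measure (noise a) {\<xi>. \<forall>z\<in>{x..y + 1}. occupation_field \<xi> z = \<sigma> z}
      = measure (noise a) {\<xi>. R \<xi>} * gc_transition (rho_bar a) (\<sigma> y) (\<sigma> (y + 1))"
  proof
    assume 0: "\<sigma> (y + 1) = 0"
    then have "{\<xi>. \<forall>z\<in>{x..y + 1}. occupation_field \<xi> z = \<sigma> z} = {\<xi>. R \<xi> \<and> vacant \<xi> (y + 1)}"
      unfolding split R_def by (auto simp: occupation_field_def)
    then show ?thesis
      using assms(2) 0 by (simp add: gc_transition_def active_density_rho_bar to_vacant)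
  next
    assume 1: "\<sigma> (y + 1) = 1"
    then have "{\<xi>. \<forall>z\<in>{x..y + 1}. occupation_field \<xi> z = \<sigma> z} = {\<xi>. R \<xi> \<and> \<not> vacant \<xi> (y + 1)}"
      unfolding split R_def by (auto simp: occupation_field_def)
    then show ?thesis
      using assms(2) 1
      by (simp add: gc_transition_def active_density_rho_bar to_occupied to_vacant right_diff_distrib)
  qed
  then show ?thesis
    by (simp add: chain_law_cylinder(2) R_def)
qed

lemma is_grand_canonical_chain_law:
  assumes "0 < a" "a \<le> 1"
  shows "is_grand_canonical (rho_bar a) (chain_law a)"
  unfolding is_grand_canonical_def
proof (intro conjI allI impI ballI)
  show "prob_space (chain_law a)"
    unfolding chain_law_def by (rule prob_space.prob_space_distr[OF prob_space_noise measurable_occupation_field])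
qed (rule sets_chain_law chain_law_shift chain_law_density[OF assms] chain_law_markov[OF assms]; assumption)+

lemma is_grand_canonical_grand_canonical:
  assumes "0 < a" "a \<le> 1"
  shows "is_grand_canonical (rho_bar a) (grand_canonical (rho_bar a))"
  unfolding grand_canonical_def
  using is_grand_canonical_chain_law[OF assms]
  by (rule theI) (rule grand_canonical_unique[OF _ is_grand_canonical_chain_law[OF assms]])

lemma grand_canonical_restrict_sites:
  assumes "N \<ge> 3" "is_grand_canonical \<rho> M" "\<sigma> \<in> configs N"
  shows "measure M {\<eta> \<in> space M. restrict \<eta> (sites N) = \<sigma>} = weight N \<rho> \<sigma>"
proof -
  have "{0..int N - 1} = insert 0 (insert (int N - 1) {1..<int N - 1})"
    using assms(1) by auto
  then have "weight N \<rho> \<sigma> = single_site \<rho> (\<sigma> 1) * (\<Prod>z\<in>{1..<int N - 1}. bond N \<rho> \<sigma> z)"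
    using assms(1) by (simp add: weight_def bond_def)
  also have "(\<Prod>z\<in>{1..<int N - 1}. bond N \<rho> \<sigma> z) = (\<Prod>z\<in>{1..<int N - 1}. gc_transition \<rho> (\<sigma> z) (\<sigma> (z + 1)))"
    by (rule prod.cong) (auto simp: bond_def)
  finally show ?thesis
    using grand_canonical_restriction[OF assms(2), of 1 "int N - 1" \<sigma>] assms(1,3)
    by (simp add: sites_def configs_def)
qed

section \<open>The stationary law\<close>

theorem proposition3p1:
  fixes N :: nat and \<kappa> \<theta> \<alpha> \<beta> :: real
  assumes "N \<ge> 3" and "\<kappa> > 0" and "\<alpha> = \<beta>" and "0 < \<alpha>" and "\<alpha> < 1"
  shows "(\<exists>!\<mu>. stationary_FEP N \<kappa> \<theta> \<alpha> \<beta> \<mu>) \<and>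
    (\<forall>\<mu>. stationary_FEP N \<kappa> \<theta> \<alpha> \<beta> \<mu> \<longrightarrow>
       (\<forall>\<sigma>\<in>configs N. pmf \<mu> \<sigma> =
          measure (grand_canonical (rho_bar \<alpha>))
            {\<eta> \<in> space (grand_canonical (rho_bar \<alpha>)). restrict \<eta> (sites N) = \<sigma>}))"
proof -
  let ?G = "grand_canonical (rho_bar \<alpha>)"
  let ?w = "\<lambda>\<sigma>. measure ?G {\<eta> \<in> space ?G. restrict \<eta> (sites N) = \<sigma>}"
  have gc: "is_grand_canonical (rho_bar \<alpha>) ?G"
    using assms by (intro is_grand_canonical_grand_canonical) auto
  have sets: "sets ?G = sets lattice_space"
    using gc by (simp add: is_grand_canonical_def)
  interpret G: prob_space ?G
    using gc by (simp add: is_grand_canonical_def)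
  interpret jump_process "configs N" "{0..int N - 1}" "fep_rate N \<kappa> \<theta> \<alpha> \<alpha>" "fep_move N"
    using assms by (intro fep_jump_process) auto
  have gen: "gen N \<kappa> \<theta> \<alpha> \<alpha> = generator"
    using assms by (intro gen_eq_generator) auto
  have stationary: "stationary_FEP N \<kappa> \<theta> \<alpha> \<beta> \<mu> \<longleftrightarrow>
      set_pmf \<mu> \<subseteq> configs N \<and> (\<forall>f. measure_pmf.expectation \<mu> (generator f) = 0)" for \<mu>
    using assms stationary_FEP_iff[of N \<kappa> \<alpha> \<beta> \<theta> \<mu>] gen by simp
  have unique: "\<mu> = \<nu>" if "stationary_FEP N \<kappa> \<theta> \<alpha> \<beta> \<mu>" "stationary_FEP N \<kappa> \<theta> \<alpha> \<beta> \<nu>" for \<mu> \<nu>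
    using that assms unfolding stationary
    by (intro stationary_unique[of "\<lambda>x\<in>sites N. 1"] full_in_closed_set) auto

  have total: "(\<Sum>\<sigma>\<in>configs N. ?w \<sigma>) = 1"
  proof -
    have "restrict \<eta> (sites N) \<in> configs N" if "\<eta> \<in> space ?G" for \<eta>
      using lattice_value[of \<eta>] that sets_eq_imp_space_eq[OF sets]
      by (auto simp: configs_def restrict_PiE_iff)
    then have "space ?G = {\<eta> \<in> space ?G. restrict \<eta> (sites N) \<in> configs N}"
      by blast
    from measure_eq_sum_restrictions[OF G.finite_measure_axioms sets this] show ?thesis
      by (simp add: sites_def configs_def G.prob_space)
  qed
  define \<pi> where "\<pi> = embed_pmf (\<lambda>\<sigma>. if \<sigma> \<in> configs N then ?w \<sigma> else 0)"
  have \<pi>: "pmf \<pi> \<sigma> = (if \<sigma> \<in> configs N then ?w \<sigma> else 0)" for \<sigma>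
    unfolding \<pi>_def
  proof (rule pmf_embed_pmf)
    have "(\<integral>\<^sup>+ \<sigma>. ennreal (if \<sigma> \<in> configs N then ?w \<sigma> else 0) \<partial>count_space UNIV)
        = (\<Sum>\<sigma>\<in>configs N. ennreal (?w \<sigma>))"
      by (subst nn_integral_count_space'[OF finite_configs[of N]]) auto
    then show "(\<integral>\<^sup>+ \<sigma>. ennreal (if \<sigma> \<in> configs N then ?w \<sigma> else 0) \<partial>count_space UNIV) = 1"
      using total by (simp add: sum_ennreal)
  qed simp
  have support: "set_pmf \<pi> \<subseteq> configs N"
    by (auto simp: set_pmf_iff \<pi> split: if_splits)
  have "stationary_FEP N \<kappa> \<theta> \<alpha> \<beta> \<pi>"
    unfolding stationary
  proof (intro conjI support allI)
    fix f
    have "measure_pmf.expectation \<pi> (generator f)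
        = (\<Sum>\<sigma>\<in>configs N. weight N (rho_bar \<alpha>) \<sigma> * generator f \<sigma>)"
      unfolding expectation_eq_sum[OF support]
      using grand_canonical_restrict_sites[OF assms(1) gc] by (intro sum.cong) (auto simp: \<pi>)
    also have "\<dots> = 0"
      using assms by (intro reversible_invariant fep_move_involutive weight_detailed_balance) auto
    finally show "measure_pmf.expectation \<pi> (generator f) = 0" .
  qed
  with unique have "stationary_FEP N \<kappa> \<theta> \<alpha> \<beta> \<mu> \<longleftrightarrow> \<mu> = \<pi>" for \<mu>
    by blast
  moreover have "pmf \<pi> \<sigma> = ?w \<sigma>" if "\<sigma> \<in> configs N" for \<sigma>
    using that by (simp add: \<pi>)
  ultimately show ?thesis
    by simp
qed

end
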